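(* Let $p,q$ be nonnegative integers and let $T\in\mathcal{O}(p,q)$ be an orthogonal transformation of $\mathbb{R}^{p,q}$. Then $T$ is the composition of at most $p+q$ reflections with respect to hyperplanes.
   Context: $\mathbb{R}^{p,q}$ denotes the real vector space $\mathbb{R}^{n}$, $n=p+q$, equipped with the non-degenerate symmetric bilinear form $\mathcal{B}(x,y)=\sum_{i=1}^{p}x_iy_i-\sum_{i=p+1}^{p+q}x_iy_i$. A linear operator $T:\mathbb{R}^{p,q}\to\mathbb{R}^{p,q}$ is an orthogonal transformation if $\mathcal{B}(Tv,Tw)=\mathcal{B}(v,w)$ for all $v,w$; the group of all orthogonal transformations is denoted $\mathcal{O}(p,q)$. For a vector $a$ with $\mathcal{B}(a,a)\neq 0$, the hyperplane associated with $a$ is $H_a=(\mathbb{R}a)^{\perp}=\{x:\mathcal{B}(x,a)=0\}$; every $v$ is uniquely $v=\lambda a+b$ with $\lambda\in\mathbb{R}$, $b\in H_a$, and the reflection with respect to the hyperplane $H_a$ is the linear map $\varphi_a(v)=-\lambda a+b$. "Reflection with respect to a hyperplane" always means a map of the form $\varphi_a$ with $\mathcal{B}(a,a)\neq0$. The identity is regarded as the composition of zero reflections. *)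

theory Defs
  imports "Jordan_Normal_Form.Matrix"
begin

text \<open>
  The space $\mathbb{R}^{p,q}$ is \<^term>\<open>carrier_vec (p + q) :: real vec set\<close>; this includes
  the zero-dimensional case.  Coordinates are numbered from 0, so the first \<open>p\<close> coordinates
  are those with index below \<open>p\<close>.
\<close>

definition bform :: "nat \<Rightarrow> nat \<Rightarrow> real vec \<Rightarrow> real vec \<Rightarrow> real" where
  "bform p q x y = (\<Sum>i = 0..<p. x $ i * y $ i) - (\<Sum>i = p..<p + q. x $ i * y $ i)"

definition linear_operator :: "nat \<Rightarrow> (real vec \<Rightarrow> real vec) \<Rightarrow> bool" where
  "linear_operator n T \<longleftrightarrow>
     T \<in> carrier_vec n \<rightarrow> carrier_vec n \<and>
     (\<forall>v \<in> carrier_vec n. \<forall>w \<in> carrier_vec n. T (v + w) = T v + T w) \<and>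
     (\<forall>c. \<forall>v \<in> carrier_vec n. T (c \<cdot>\<^sub>v v) = c \<cdot>\<^sub>v T v)"

text \<open>Values of an operator outside \<^term>\<open>carrier_vec (p + q)\<close> are irrelevant and unconstrained.\<close>

definition orthogonal_group :: "nat \<Rightarrow> nat \<Rightarrow> (real vec \<Rightarrow> real vec) set" where
  "orthogonal_group p q =
     {T. linear_operator (p + q) T \<and>
         (\<forall>v \<in> carrier_vec (p + q). \<forall>w \<in> carrier_vec (p + q).
            bform p q (T v) (T w) = bform p q v w)}"

definition hyperplane :: "nat \<Rightarrow> nat \<Rightarrow> real vec \<Rightarrow> real vec set" where
  "hyperplane p q a = {x \<in> carrier_vec (p + q). bform p q x a = 0}"

text \<open>
  Meaningful only for \<open>a\<close> in the space with \<^prop>\<open>bform p q a a \<noteq> 0\<close>, when the decomposition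
  of \<open>v\<close> exists and is unique (lemmas \<open>hyperplane_decomposition_exists\<close> and
  \<open>hyperplane_decomposition_unique\<close> below).
\<close>

definition reflection :: "nat \<Rightarrow> nat \<Rightarrow> real vec \<Rightarrow> real vec \<Rightarrow> real vec" where
  "reflection p q a v =
     (THE w. \<exists>c b. b \<in> hyperplane p q a \<and> v = c \<cdot>\<^sub>v a + b \<and> w = (- c) \<cdot>\<^sub>v a + b)"

lemma bform_add_smult_left:
  assumes "a \<in> carrier_vec (p + q)" "b \<in> carrier_vec (p + q)"
  shows "bform p q (c \<cdot>\<^sub>v a + b) x = c * bform p q a x + bform p q b x"
proof -
  have "(\<Sum>i = 0..<p. (c \<cdot>\<^sub>v a + b) $ i * x $ i)
      = c * (\<Sum>i = 0..<p. a $ i * x $ i) + (\<Sum>i = 0..<p. b $ i * x $ i)"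
    unfolding sum_distrib_left sum.distrib[symmetric]
    using assms by (intro sum.cong) (auto simp: algebra_simps)
  moreover have "(\<Sum>i = p..<p + q. (c \<cdot>\<^sub>v a + b) $ i * x $ i)
      = c * (\<Sum>i = p..<p + q. a $ i * x $ i) + (\<Sum>i = p..<p + q. b $ i * x $ i)"
    unfolding sum_distrib_left sum.distrib[symmetric]
    using assms by (intro sum.cong) (auto simp: algebra_simps)
  ultimately show ?thesis
    unfolding bform_def by (simp add: algebra_simps)
qed

lemma hyperplane_decomposition_exists:
  assumes a: "a \<in> carrier_vec (p + q)" and na: "bform p q a a \<noteq> 0"
    and v: "v \<in> carrier_vec (p + q)"
  shows "\<exists>c. \<exists>b \<in> hyperplane p q a. v = c \<cdot>\<^sub>v a + b"
proof -
  define c where "c = bform p q v a / bform p q a a"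
  define b where "b = (- c) \<cdot>\<^sub>v a + v"
  have "bform p q b a = 0"
    unfolding b_def bform_add_smult_left[OF a v] using na by (simp add: c_def)
  then have "b \<in> hyperplane p q a"
    using a v by (simp add: hyperplane_def b_def)
  moreover have "v = c \<cdot>\<^sub>v a + b"
    using a v by (intro eq_vecI) (auto simp: b_def)
  ultimately show ?thesis by blast
qed

lemma hyperplane_decomposition_unique:
  assumes a: "a \<in> carrier_vec (p + q)" and na: "bform p q a a \<noteq> 0"
    and b: "b \<in> hyperplane p q a" and b': "b' \<in> hyperplane p q a"
    and eq: "c \<cdot>\<^sub>v a + b = c' \<cdot>\<^sub>v a + b'"
  shows "c = c'" and "b = b'"
proof -
  have bc: "b \<in> carrier_vec (p + q)" "b' \<in> carrier_vec (p + q)"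
    and b0: "bform p q b a = 0" "bform p q b' a = 0"
    using b b' by (auto simp: hyperplane_def)
  have "bform p q (c \<cdot>\<^sub>v a + b) a = bform p q (c' \<cdot>\<^sub>v a + b') a"
    by (simp only: eq)
  then have "c * bform p q a a = c' * bform p q a a"
    unfolding bform_add_smult_left[OF a bc(1)] bform_add_smult_left[OF a bc(2)] b0 by simp
  with na show c: "c = c'" by simp
  have "b = (- c) \<cdot>\<^sub>v a + (c \<cdot>\<^sub>v a + b)"
    using a bc by (intro eq_vecI) auto
  also have "\<dots> = (- c') \<cdot>\<^sub>v a + (c' \<cdot>\<^sub>v a + b')"
    unfolding eq by (simp only: c)
  also have "\<dots> = b'"
    using a bc by (intro eq_vecI) auto
  finally show "b = b'" .
qed

lemma reflection_decomposition:
  assumes a: "a \<in> carrier_vec (p + q)" and na: "bform p q a a \<noteq> 0"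
    and b: "b \<in> hyperplane p q a"
  shows "reflection p q a (c \<cdot>\<^sub>v a + b) = (- c) \<cdot>\<^sub>v a + b"
  unfolding reflection_def
proof (rule the_equality)
  show "\<exists>c' b'. b' \<in> hyperplane p q a \<and> c \<cdot>\<^sub>v a + b = c' \<cdot>\<^sub>v a + b' \<and>
      (- c) \<cdot>\<^sub>v a + b = (- c') \<cdot>\<^sub>v a + b'"
    by (intro exI[of _ c] exI[of _ b] conjI refl b)
next
  fix w
  assume "\<exists>c' b'. b' \<in> hyperplane p q a \<and> c \<cdot>\<^sub>v a + b = c' \<cdot>\<^sub>v a + b' \<and>
      w = (- c') \<cdot>\<^sub>v a + b'"
  then obtain c' b' where b': "b' \<in> hyperplane p q a"
    and eq: "c \<cdot>\<^sub>v a + b = c' \<cdot>\<^sub>v a + b'" and w: "w = (- c') \<cdot>\<^sub>v a + b'"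
    by (elim exE conjE)
  show "w = (- c) \<cdot>\<^sub>v a + b"
    using hyperplane_decomposition_unique[OF a na b b' eq] w by (simp only:)
qed

end

theory Submission
  imports Defs "Jordan_Normal_Form.VS_Connect"
begin

text \<open>
  Induct on the codimension of a nondegenerate subspace fixed pointwise by \<open>T\<close>, given by an
  orthogonal frame \<open>E\<close>; let \<open>U\<close> be its orthogonal complement.  If some anisotropic \<open>a \<in> U\<close> is
  fixed by \<open>T\<close>, or has \<open>T a - a\<close> anisotropic (so that one reflection carries \<open>T a\<close> back to \<open>a\<close>),
  then \<open>E\<close> grows by \<open>a\<close>.  Otherwise \<open>N = T - 1\<close> maps \<open>U\<close> onto a totally isotropic subspace, so \<open>N\<close>
  is skew and \<open>N\<^sup>2 = 0\<close> on \<open>U\<close>.  In that case choose any anisotropic \<open>a \<in> U\<close> and put \<open>w = N a\<close>, a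
  nonzero isotropic vector fixed by \<open>T\<close> and orthogonal to \<open>a\<close>.  For a suitable \<open>v \<in> U\<close> not orthogonal
  to \<open>w\<close>, the reflection in \<open>a\<close> followed by a second one turns \<open>T\<close> into a map that fixes both \<open>v\<close>
  and \<open>w\<close>, hence a hyperbolic plane.  So two reflections enlarge \<open>E\<close> by two vectors, and the
  bound \<open>p + q\<close> is met without a parity argument on determinants.
\<close>

section \<open>The bilinear form\<close>

lemma bform_comm: "bform p q x y = bform p q y x"
  unfolding bform_def by (simp add: mult.commute)

context
  fixes p q :: nat
begin

abbreviation Rpq :: "real vec set" where "Rpq \<equiv> carrier_vec (p + q)"
abbreviation B :: "real vec \<Rightarrow> real vec \<Rightarrow> real" where "B \<equiv> bform p q"

lemma bform_add_left: "\<lbrakk>x \<in> Rpq; y \<in> Rpq\<rbrakk> \<Longrightarrow> B (x + y) z = B x z + B y z"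
  using bform_add_smult_left[of x p q y 1 z] by simp

lemma bform_smult_left: "x \<in> Rpq \<Longrightarrow> B (c \<cdot>\<^sub>v x) z = c * B x z"
  using bform_add_smult_left[of x p q "0\<^sub>v (p + q)" c z]
  by (simp add: bform_def)

lemma bform_minus_left: "\<lbrakk>x \<in> Rpq; y \<in> Rpq\<rbrakk> \<Longrightarrow> B (x - y) z = B x z - B y z"
proof -
  assume "x \<in> Rpq" "y \<in> Rpq"
  then have "x - y = (-1) \<cdot>\<^sub>v y + x"
    by (intro eq_vecI) auto
  with \<open>x \<in> Rpq\<close> \<open>y \<in> Rpq\<close> show ?thesis
    by (simp add: bform_add_smult_left)
qed

lemma bform_add_right: "\<lbrakk>x \<in> Rpq; y \<in> Rpq\<rbrakk> \<Longrightarrow> B z (x + y) = B z x + B z y"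
  using bform_add_left by (simp add: bform_comm[of _ _ z])

lemma bform_smult_right: "x \<in> Rpq \<Longrightarrow> B z (c \<cdot>\<^sub>v x) = c * B z x"
  using bform_smult_left by (simp add: bform_comm[of _ _ z])

lemma bform_minus_right: "\<lbrakk>x \<in> Rpq; y \<in> Rpq\<rbrakk> \<Longrightarrow> B z (x - y) = B z x - B z y"
  using bform_minus_left by (simp add: bform_comm[of _ _ z])

lemmas bform_simps = bform_add_left bform_smult_left bform_minus_left
  bform_add_right bform_smult_right bform_minus_right

lemma bform_zero: "B (0\<^sub>v (p + q)) x = 0" "B x (0\<^sub>v (p + q)) = 0"
  by (simp_all add: bform_def)

lemma bform_nondegenerate:
  assumes w: "w \<in> Rpq" and nz: "w \<noteq> 0\<^sub>v (p + q)"
  shows "\<exists>x \<in> Rpq. B x w \<noteq> 0"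
proof -
  \<comment> \<open>Negating the last \<open>q\<close> coordinates of \<open>w\<close> turns the
    pairing into the Euclidean sum of squares.\<close>
  define x where "x = vec (p + q) (\<lambda>i. if i < p then w $ i else - w $ i)"
  obtain i where i: "i < p + q" "w $ i \<noteq> 0"
    using w nz by (metis carrier_vecD eq_vecI index_zero_vec)
  have "B x w = (\<Sum>i = 0..<p. (w $ i)\<^sup>2) + (\<Sum>i = p..<p + q. (w $ i)\<^sup>2)"
    unfolding bform_def x_def by (simp add: power2_eq_square sum_negf)
  also have "\<dots> = (\<Sum>i = 0..<p + q. (w $ i)\<^sup>2)"
    by (rule sum.atLeastLessThan_concat) auto
  also have "\<dots> > 0"
    using i by (intro sum_pos2[of _ i]) auto
  finally show ?thesis
    by (intro bexI[of _ x]) (auto simp: x_def)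
qed


section \<open>Reflections and orthogonal transformations\<close>

lemma reflection_eq:
  assumes a: "a \<in> Rpq" "B a a \<noteq> 0" and v: "v \<in> Rpq"
  shows "reflection p q a v = v - (2 * B v a / B a a) \<cdot>\<^sub>v a"
proof -
  define c where "c = B v a / B a a"
  have b: "v - c \<cdot>\<^sub>v a \<in> hyperplane p q a"
    using a v by (simp add: hyperplane_def bform_simps c_def)
  have "v = c \<cdot>\<^sub>v a + (v - c \<cdot>\<^sub>v a)"
    using a v by (intro eq_vecI) auto
  then have "reflection p q a v = (- c) \<cdot>\<^sub>v a + (v - c \<cdot>\<^sub>v a)"
    using reflection_decomposition[OF a b] by metis
  also have "\<dots> = v - (2 * c) \<cdot>\<^sub>v a"
    using a v by (intro eq_vecI) (auto simp: algebra_simps)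
  finally show ?thesis by (simp add: c_def)
qed

lemma reflection_closed: "\<lbrakk>a \<in> Rpq; B a a \<noteq> 0; v \<in> Rpq\<rbrakk> \<Longrightarrow> reflection p q a v \<in> Rpq"
  by (simp add: reflection_eq)

lemma reflection_bform:
  assumes "a \<in> Rpq" "B a a \<noteq> 0" "v \<in> Rpq" "w \<in> Rpq"
  shows "B (reflection p q a v) (reflection p q a w) = B v w"
  using assms by (simp add: reflection_eq bform_simps bform_comm field_simps)

lemma reflection_orthogonal:
  assumes a: "a \<in> Rpq" "B a a \<noteq> 0"
  shows "reflection p q a \<in> orthogonal_group p q"
proof -
  have "reflection p q a (v + w) = reflection p q a v + reflection p q a w"
    if "v \<in> Rpq" "w \<in> Rpq" for v w
    using a that by (intro eq_vecI) (auto simp: reflection_eq bform_simps field_simps)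
  moreover have "reflection p q a (c \<cdot>\<^sub>v v) = c \<cdot>\<^sub>v reflection p q a v" if "v \<in> Rpq" for c v
    using a that by (intro eq_vecI) (auto simp: reflection_eq bform_simps field_simps)
  ultimately show ?thesis
    using a by (auto simp: orthogonal_group_def linear_operator_def reflection_closed reflection_bform)
qed

lemma reflection_involutive:
  assumes "a \<in> Rpq" "B a a \<noteq> 0" "v \<in> Rpq"
  shows "reflection p q a (reflection p q a v) = v"
  using assms by (intro eq_vecI) (auto simp: reflection_eq bform_simps field_simps)

lemma reflection_fixes:
  assumes "a \<in> Rpq" "B a a \<noteq> 0" "v \<in> Rpq" "B v a = 0"
  shows "reflection p q a v = v"
  using assms by (auto simp: reflection_eq)

text \<open>Equal values of the form make \<open>x + y\<close> orthogonal to \<open>x - y\<close>,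
  so the reflection keeps one half-sum and negates the other, exchanging \<open>x\<close> and
  \<open>y\<close>.\<close>

lemma reflection_moves:
  assumes x: "x \<in> Rpq" and y: "y \<in> Rpq" and eq: "B x x = B y y" and nz: "B (x - y) (x - y) \<noteq> 0"
  shows "reflection p q (x - y) x = y"
proof -
  have "2 * B x (x - y) = B (x - y) (x - y)"
    using x y eq by (simp add: bform_simps bform_comm)
  then have "reflection p q (x - y) x = x - 1 \<cdot>\<^sub>v (x - y)"
    using x y nz by (simp add: reflection_eq)
  also have "\<dots> = y"
    using x y by (intro eq_vecI) auto
  finally show ?thesis .
qed

lemma orthogonal_comp:
  "\<lbrakk>S \<in> orthogonal_group p q; T \<in> orthogonal_group p q\<rbrakk> \<Longrightarrow> S \<circ> T \<in> orthogonal_group p q"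
  by (auto simp: orthogonal_group_def linear_operator_def Pi_iff)

lemma orthogonal_closed: "\<lbrakk>T \<in> orthogonal_group p q; v \<in> Rpq\<rbrakk> \<Longrightarrow> T v \<in> Rpq"
  and orthogonal_add: "\<lbrakk>T \<in> orthogonal_group p q; v \<in> Rpq; w \<in> Rpq\<rbrakk> \<Longrightarrow> T (v + w) = T v + T w"
  and orthogonal_smult: "\<lbrakk>T \<in> orthogonal_group p q; v \<in> Rpq\<rbrakk> \<Longrightarrow> T (c \<cdot>\<^sub>v v) = c \<cdot>\<^sub>v T v"
  and orthogonal_bform: "\<lbrakk>T \<in> orthogonal_group p q; v \<in> Rpq; w \<in> Rpq\<rbrakk> \<Longrightarrow> B (T v) (T w) = B v w"
  by (auto simp: orthogonal_group_def linear_operator_def)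

lemma orthogonal_minus:
  assumes "T \<in> orthogonal_group p q" "v \<in> Rpq" "w \<in> Rpq"
  shows "T (v - w) = T v - T w"
proof -
  have eq: "x - y = x + (-1) \<cdot>\<^sub>v y" if "x \<in> Rpq" "y \<in> Rpq" for x y :: "real vec"
    using that by (intro eq_vecI) auto
  show ?thesis
    using assms by (simp only: eq orthogonal_add orthogonal_smult orthogonal_closed smult_carrier_vec)
qed

lemma orthogonal_zero: "T \<in> orthogonal_group p q \<Longrightarrow> T (0\<^sub>v (p + q)) = 0\<^sub>v (p + q)"
  using orthogonal_minus[of T "0\<^sub>v (p + q)" "0\<^sub>v (p + q)"] orthogonal_closed[of T "0\<^sub>v (p + q)"]
  by simp

text \<open>Agreement is required only on \<open>Rpq\<close>, since operators are unconstrained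
  elsewhere.\<close>

definition reflection_product :: "nat \<Rightarrow> (real vec \<Rightarrow> real vec) \<Rightarrow> bool" where
  "reflection_product m T \<longleftrightarrow> (\<exists>as. length as \<le> m \<and> (\<forall>a \<in> set as. a \<in> Rpq \<and> B a a \<noteq> 0) \<and>
     (\<forall>v \<in> Rpq. T v = foldr (reflection p q) as v))"

lemma reflection_product_mono: "\<lbrakk>reflection_product m T; m \<le> n\<rbrakk> \<Longrightarrow> reflection_product n T"
  unfolding reflection_product_def by (meson le_trans)

lemma reflection_product_Suc:
  assumes T: "T \<in> orthogonal_group p q" and a: "a \<in> Rpq" "B a a \<noteq> 0"
    and "reflection_product m (reflection p q a \<circ> T)"
  shows "reflection_product (Suc m) T"
proof -
  obtain as where as: "length as \<le> m" "\<forall>a \<in> set as. a \<in> Rpq \<and> B a a \<noteq> 0"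
    "\<forall>v \<in> Rpq. reflection p q a (T v) = foldr (reflection p q) as v"
    using assms(4) by (auto simp: reflection_product_def)
  have "T v = foldr (reflection p q) (a # as) v" if "v \<in> Rpq" for v
    using as(3) that reflection_involutive[OF a orthogonal_closed[OF T that]] by auto
  with as(1,2) a show ?thesis
    unfolding reflection_product_def by (intro exI[of _ "a # as"]) auto
qed


section \<open>Orthogonal frames and their complements\<close>

text \<open>Encodes a nondegenerate subspace by a diagonalizing basis, so that its codimension is
  \<open>p + q - card E\<close>.\<close>

definition orthogonal_frame :: "real vec set \<Rightarrow> bool" where
  "orthogonal_frame E \<longleftrightarrow> finite E \<and> E \<subseteq> Rpq \<and> (\<forall>e \<in> E. B e e \<noteq> 0) \<and>
     (\<forall>e \<in> E. \<forall>f \<in> E. e \<noteq> f \<longrightarrow> B e f = 0)"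

definition form_complement :: "real vec set \<Rightarrow> real vec set" where
  "form_complement E = {u \<in> Rpq. \<forall>e \<in> E. B u e = 0}"

lemma form_complement_closed:
  assumes "E \<subseteq> Rpq"
  shows "x \<in> form_complement E \<Longrightarrow> x \<in> Rpq"
    and "\<lbrakk>x \<in> form_complement E; y \<in> form_complement E\<rbrakk> \<Longrightarrow> x + y \<in> form_complement E"
    and "\<lbrakk>x \<in> form_complement E; y \<in> form_complement E\<rbrakk> \<Longrightarrow> x - y \<in> form_complement E"
    and "x \<in> form_complement E \<Longrightarrow> c \<cdot>\<^sub>v x \<in> form_complement E"
  using assms by (auto simp: form_complement_def bform_simps)

lemma orthogonal_frame_insert:
  assumes "orthogonal_frame E" "a \<in> form_complement E" "B a a \<noteq> 0"
  shows "orthogonal_frame (insert a E)" "card (insert a E) = Suc (card E)"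
proof -
  show "orthogonal_frame (insert a E)"
    using assms by (auto simp: orthogonal_frame_def form_complement_def bform_comm)
  have "a \<notin> E"
    using assms by (auto simp: form_complement_def)
  then show "card (insert a E) = Suc (card E)"
    using assms by (simp add: orthogonal_frame_def)
qed

text \<open>Frames are independent: the span of the other vectors lies in the hyperplane orthogonal
  to \<open>e\<close>, which misses the anisotropic \<open>e\<close>. The bound makes natural-number
  subtraction exact in the induction.\<close>

lemma orthogonal_frame_card_le:
  assumes "orthogonal_frame E"
  shows "card E \<le> p + q"
proof -
  interpret vec_space "TYPE(real)" "p + q" .
  have "finite E" using assms by (simp add: orthogonal_frame_def)
  then have "orthogonal_frame E \<Longrightarrow> lin_indpt E"
  proof (induction E rule: finite_induct)
    case empty
    show ?case by (simp add: lin_dep_def)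
  next
    case (insert e F)
    then have F: "orthogonal_frame F" and e: "e \<in> Rpq" "B e e \<noteq> 0" and FV: "F \<subseteq> Rpq"
      by (auto simp: orthogonal_frame_def)
    have sub: "submodule class_ring {y \<in> Rpq. B y e = 0} (module_vec TYPE(real) (p + q))"
      using vec_module by (auto intro!: submodule.intro simp: module_vec_simps bform_simps bform_zero)
    have "F \<subseteq> {y \<in> Rpq. B y e = 0}"
      using insert.prems insert.hyps by (auto simp: orthogonal_frame_def)
    with sub have "span F \<subseteq> {y \<in> Rpq. B y e = 0}"
      by (intro span_is_subset) auto
    with e have "e \<notin> span F" by auto
    with insert F e FV show ?case
      using lin_dep_iff_in_span[of F e] by auto
  qed
  then show ?thesis
    using li_le_dim(2)[OF fin_dim] assms by (auto simp: orthogonal_frame_def dim_is_n)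
qed

text \<open>Gram-Schmidt projection onto the span of \<open>E\<close>, with the span replaced by any
  suitable \<open>W\<close> containing \<open>E\<close>. Later \<open>W\<close> is either a
  hyperplane or the set of fixed vectors of \<open>T\<close>.\<close>

lemma orthogonal_frame_decomposition:
  assumes "orthogonal_frame E" "x \<in> Rpq" and W: "E \<subseteq> W" "W \<subseteq> Rpq" "0\<^sub>v (p + q) \<in> W"
    and closed: "\<And>c y z. y \<in> W \<Longrightarrow> z \<in> W \<Longrightarrow> y + c \<cdot>\<^sub>v z \<in> W"
  shows "\<exists>y \<in> W. x - y \<in> form_complement E"
proof -
  have "finite E" using assms by (simp add: orthogonal_frame_def)
  then show ?thesis using assms(1) W(1)
  proof (induction E rule: finite_induct)
    case empty
    show ?case
      using \<open>x \<in> Rpq\<close> W by (intro bexI[of _ "0\<^sub>v (p + q)"]) (auto simp: form_complement_def)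
  next
    case (insert e F)
    then have e: "e \<in> Rpq" "B e e \<noteq> 0" "e \<in> W" "\<forall>f \<in> F. B e f = 0"
      by (auto simp: orthogonal_frame_def)
    obtain y where y: "y \<in> W" "x - y \<in> form_complement F"
      using insert by (auto simp: orthogonal_frame_def)
    define c where "c = B (x - y) e / B e e"
    have yV: "y \<in> Rpq" using y W by auto
    have eq: "x - (y + c \<cdot>\<^sub>v e) = (x - y) - c \<cdot>\<^sub>v e"
      using \<open>x \<in> Rpq\<close> e yV by (intro eq_vecI) auto
    have "x - (y + c \<cdot>\<^sub>v e) \<in> form_complement (insert e F)"
      unfolding eq form_complement_def
      using y(2) e \<open>x \<in> Rpq\<close> yV
      by (auto simp: bform_minus_left[of "x - y"] bform_smult_left c_def form_complement_def)
    with closed[OF y(1) e(3)] show ?case by blast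
  qed
qed

text \<open>Removing from a test vector its projection to the span of \<open>E\<close> does not
  change its pairing with \<open>w\<close>.\<close>

lemma form_complement_nondegenerate:
  assumes E: "orthogonal_frame E" and w: "w \<in> form_complement E" "w \<noteq> 0\<^sub>v (p + q)"
  shows "\<exists>x \<in> form_complement E. B x w \<noteq> 0"
proof -
  have wV: "w \<in> Rpq" using w by (simp add: form_complement_def)
  obtain x where x: "x \<in> Rpq" "B x w \<noteq> 0"
    using bform_nondegenerate[OF wV w(2)] by blast
  have "\<exists>y \<in> {y \<in> Rpq. B y w = 0}. x - y \<in> form_complement E"
    using E w x by (intro orthogonal_frame_decomposition)
      (auto simp: bform_simps bform_zero orthogonal_frame_def form_complement_def
        bform_comm)
  then obtain y where "y \<in> Rpq" "B y w = 0" "x - y \<in> form_complement E" by blast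
  with x show ?thesis
    by (intro bexI[of _ "x - y"]) (auto simp: bform_simps)
qed

text \<open>By polarization, a form vanishing on all \<open>B a a\<close> would vanish on the whole
  complement.\<close>

lemma form_complement_anisotropic:
  assumes E: "orthogonal_frame E" and w: "w \<in> form_complement E" "w \<noteq> 0\<^sub>v (p + q)"
  shows "\<exists>a \<in> form_complement E. B a a \<noteq> 0"
proof (rule ccontr)
  assume iso: "\<not> ?thesis"
  have EV: "E \<subseteq> Rpq" using E by (simp add: orthogonal_frame_def)
  note U = form_complement_closed[OF EV]
  obtain x where x: "x \<in> form_complement E" "B x w \<noteq> 0"
    using form_complement_nondegenerate[OF E w] by blast
  have "B (x + w) (x + w) = B x x + 2 * B x w + B w w"
    using U(1)[OF x(1)] U(1)[OF w(1)] by (simp add: bform_simps bform_comm)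
  with iso x w U(2)[OF x(1) w(1)] show False by auto
qed

lemma orthogonal_identity_if_complement_trivial:
  assumes E: "orthogonal_frame E" and triv: "form_complement E \<subseteq> {0\<^sub>v (p + q)}"
    and T: "T \<in> orthogonal_group p q" and fixE: "\<And>e. e \<in> E \<Longrightarrow> T e = e" and x: "x \<in> Rpq"
  shows "T x = x"
proof -
  have "\<exists>y \<in> {y \<in> Rpq. T y = y}. x - y \<in> form_complement E"
    using E T fixE x by (intro orthogonal_frame_decomposition)
      (auto simp: orthogonal_frame_def orthogonal_zero orthogonal_add orthogonal_smult)
  then obtain y where y: "y \<in> Rpq" "T y = y" "x - y = 0\<^sub>v (p + q)"
    using triv by blast
  have "x = (x - y) + y" using x y(1) by (intro eq_vecI) auto
  also have "\<dots> = y" using y by simp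
  finally show ?thesis using y by simp
qed

lemma form_complement_invariant:
  assumes E: "E \<subseteq> Rpq" and T: "T \<in> orthogonal_group p q"
    and fixE: "\<And>e. e \<in> E \<Longrightarrow> T e = e" and u: "u \<in> form_complement E"
  shows "T u \<in> form_complement E"
proof -
  have "B (T u) e = 0" if "e \<in> E" for e
    using orthogonal_bform[OF T, of u e] fixE[OF that] that E u
    by (auto simp: form_complement_def)
  then show ?thesis
    using T u by (auto simp: form_complement_def orthogonal_closed)
qed

text \<open>The fixed plane of \<open>v\<close> and \<open>w\<close> has an isotropic basis
  \<open>w\<close>, \<open>z\<close>; then \<open>w + z\<close> and \<open>w - z\<close> are
  orthogonal, with values \<open>2 * B v w\<close> and \<open>- 2 * B v w\<close>.\<close>

lemma hyperbolic_plane_frame: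
  assumes E: "orthogonal_frame E" and v: "v \<in> form_complement E"
    and w: "w \<in> form_complement E" "B w w = 0" and vw: "B v w \<noteq> 0"
    and T: "T \<in> orthogonal_group p q" and fixed: "\<And>e. e \<in> E \<Longrightarrow> T e = e" "T v = v" "T w = w"
  shows "\<exists>F. orthogonal_frame F \<and> card F = card E + 2 \<and> (\<forall>f \<in> F. T f = f)"
proof -
  have EV: "E \<subseteq> Rpq" using E by (simp add: orthogonal_frame_def)
  note U = form_complement_closed[OF EV]
  \<comment> \<open>The multiple of \<open>w\<close> is the one that makes \<open>z\<close>
    isotropic.\<close>
  define z where "z = v - (B v v / (2 * B v w)) \<cdot>\<^sub>v w"
  have z: "z \<in> form_complement E" "T z = z"
    using U T fixed v w by (auto simp: z_def orthogonal_minus orthogonal_smult)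
  note V = U(1)[OF v] U(1)[OF w(1)] U(1)[OF z(1)]
  have zw: "B z w = B v w" "B w z = B v w" and zz: "B z z = 0"
    using V w vw by (auto simp: z_def bform_simps bform_comm field_simps)
  have f: "w + z \<in> form_complement E" "B (w + z) (w + z) \<noteq> 0"
    using U z w V zw zz vw by (auto simp: bform_simps)
  have "w - z \<in> form_complement (insert (w + z) E)" "B (w - z) (w - z) \<noteq> 0"
    using U(3)[OF w(1) z(1)] z w V zw zz vw by (auto simp: form_complement_def bform_simps)
  from orthogonal_frame_insert[OF orthogonal_frame_insert(1)[OF E f] this]
    orthogonal_frame_insert(2)[OF E f]
  show ?thesis
    using T fixed z V
    by (intro exI[of _ "insert (w - z) (insert (w + z) E)"])
      (auto simp: orthogonal_add orthogonal_minus)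
qed

section \<open>The exceptional case\<close>

lemma displacement_totally_isotropic:
  assumes E: "orthogonal_frame E" and T: "T \<in> orthogonal_group p q"
    and exc: "\<And>u. u \<in> form_complement E \<Longrightarrow> B u u \<noteq> 0 \<Longrightarrow> B (T u - u) (T u - u) = 0"
    and a: "a \<in> form_complement E" "B a a \<noteq> 0"
    and u: "u \<in> form_complement E"
  shows "B (T u - u) (T u - u) = 0"
proof (cases "B u u = 0")
  case True
  have EV: "E \<subseteq> Rpq" using E by (simp add: orthogonal_frame_def)
  note U = form_complement_closed[OF EV]
  note V = U(1)[OF a(1)] U(1)[OF u]
  have TV: "T a \<in> Rpq" "T u \<in> Rpq" using V T by (auto simp: orthogonal_closed)
  define b where "b = 2 * B u a / B a a"
  \<comment> \<open>Being larger than the absolute value of \<open>b\<close>, \<open>s\<close> keeps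
    both \<open>s\<close> and \<open>- s\<close> away from the roots \<open>0\<close> and
    \<open>- b\<close>.\<close>
  define s where "s = \<bar>b\<bar> + 1"
  have aa: "B (T a - a) (T a - a) = 0" using exc a by blast
  \<comment> \<open>On the line \<open>u + t a\<close> the form is \<open>t (b + t) B a a\<close>, while the form of the displacement
    is affine in \<open>t\<close>; so it vanishes at \<open>t = 0\<close> because it does so at \<open>t = \<plusminus>s\<close>.\<close>
  have line: "B (T u - u) (T u - u) + 2 * t * B (T u - u) (T a - a) = 0"
    if "t \<noteq> 0" "b + t \<noteq> 0" for t
  proof -
    have "B (u + t \<cdot>\<^sub>v a) (u + t \<cdot>\<^sub>v a) = t * (b + t) * B a a"
      using V True a(2) by (simp add: bform_simps bform_comm b_def field_simps)
    then have "B (u + t \<cdot>\<^sub>v a) (u + t \<cdot>\<^sub>v a) \<noteq> 0" using that a by simp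
    then have *: "B (T (u + t \<cdot>\<^sub>v a) - (u + t \<cdot>\<^sub>v a)) (T (u + t \<cdot>\<^sub>v a) - (u + t \<cdot>\<^sub>v a)) = 0"
      using exc U(2)[OF u U(4)[OF a(1)]] by blast
    have "T (u + t \<cdot>\<^sub>v a) - (u + t \<cdot>\<^sub>v a) = (T u - u) + t \<cdot>\<^sub>v (T a - a)"
      using V TV T by (intro eq_vecI) (auto simp: orthogonal_add orthogonal_smult algebra_simps)
    moreover have "B ((T u - u) + t \<cdot>\<^sub>v (T a - a)) ((T u - u) + t \<cdot>\<^sub>v (T a - a)) =
        B (T u - u) (T u - u) + 2 * t * B (T u - u) (T a - a) + t * t * B (T a - a) (T a - a)"
      using V TV
      by (simp add: bform_add_left bform_add_right bform_smult_left bform_smult_right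
          bform_comm algebra_simps)
    ultimately show ?thesis using * aa by simp
  qed
  have "s \<noteq> 0" "b + s \<noteq> 0" "- s \<noteq> 0" "b + - s \<noteq> 0" by (auto simp: s_def)
  then show ?thesis using line[of s] line[of "- s"] by auto
qed (use exc u in blast)

text \<open>The reflection in \<open>a\<close> makes the displacement \<open>c\<close> of a suitable
  \<open>v\<close> anisotropic; the reflection in \<open>c\<close> then brings \<open>v\<close> back
  without moving \<open>w\<close> or \<open>E\<close>.\<close>

lemma exceptional_reduction:
  assumes E: "orthogonal_frame E" and T: "T \<in> orthogonal_group p q"
    and fixE: "\<And>e. e \<in> E \<Longrightarrow> T e = e"
    and iso: "\<And>u. u \<in> form_complement E \<Longrightarrow> B (T u - u) (T u - u) = 0"
    and a: "a \<in> form_complement E" "B a a \<noteq> 0" and moved: "T a \<noteq> a"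
  shows "\<exists>c \<in> Rpq. \<exists>F. B c c \<noteq> 0 \<and> orthogonal_frame F \<and> card F = card E + 2 \<and>
    (\<forall>f \<in> F. (reflection p q c \<circ> (reflection p q a \<circ> T)) f = f)"
proof -
  have EV: "E \<subseteq> Rpq" using E by (simp add: orthogonal_frame_def)
  note U = form_complement_closed[OF EV]
  have TU: "T u \<in> form_complement E" if "u \<in> form_complement E" for u
    using form_complement_invariant[OF EV T fixE that] .
  define N where "N u = T u - u" for u
  have NU: "N u \<in> form_complement E" if "u \<in> form_complement E" for u
    unfolding N_def using U(3) TU that by blast
  have polar: "B (N u) (N v) = 0" if uv: "u \<in> form_complement E" "v \<in> form_complement E" for u v
  proof -
    note V = U(1)[OF uv(1)] U(1)[OF uv(2)] U(1)[OF NU[OF uv(1)]] U(1)[OF NU[OF uv(2)]]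
    have "N (u + v) = N u + N v"
      using V orthogonal_closed[OF T V(1)] orthogonal_closed[OF T V(2)] T
      unfolding N_def by (intro eq_vecI) (auto simp: orthogonal_add)
    then have "B (N u + N v) (N u + N v) = 0"
      using iso[OF U(2)[OF uv]] by (simp add: N_def)
    then show ?thesis
      using iso[OF uv(1)] iso[OF uv(2)] V unfolding N_def[symmetric]
      by (simp add: bform_simps bform_comm)
  qed
  \<comment> \<open>Expand \<open>B (T u) (T v) = B u v\<close> with \<open>T = 1 + N\<close>; the
    quadratic term vanishes by \<open>polar\<close>.\<close>
  have skew: "B (N u) v = - B u (N v)"
    if uv: "u \<in> form_complement E" "v \<in> form_complement E" for u v
  proof -
    note V = U(1)[OF uv(1)] U(1)[OF uv(2)]
    show ?thesis
      using polar[OF uv] orthogonal_bform[OF T V] V orthogonal_closed[OF T V(1)] orthogonal_closed[OF T V(2)]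
      unfolding N_def by (simp add: bform_simps)
  qed
  define w where "w = N a"
  have w: "w \<in> form_complement E" using NU a by (simp add: w_def)
  note V = U(1)[OF a(1)] U(1)[OF w]
  have TaV: "T a \<in> Rpq" using T V by (simp add: orthogonal_closed)
  have "w \<noteq> 0\<^sub>v (p + q)"
  proof
    assume "w = 0\<^sub>v (p + q)"
    moreover have "T a = w + a"
      using TaV V unfolding w_def N_def by (intro eq_vecI) auto
    ultimately show False using moved V by simp
  qed
  then obtain x where x: "x \<in> form_complement E" "B x w \<noteq> 0"
    using form_complement_nondegenerate[OF E w] by blast
  have ww: "B w w = 0" using polar a by (simp add: w_def)
  have aw: "B a w = 0" "B w a = 0"
    using skew[OF a(1) a(1)] bform_comm[of p q a "N a"] by (auto simp: w_def)
  \<comment> \<open>This is \<open>N\<close> applied twice to \<open>a\<close>: skewness moves one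
    \<open>N\<close> across the form, \<open>polar\<close> gives zero, and nondegeneracy
    concludes.\<close>
  have "N w = 0\<^sub>v (p + q)"
  proof (rule ccontr)
    assume "N w \<noteq> 0\<^sub>v (p + q)"
    then obtain y where y: "y \<in> form_complement E" "B y (N w) \<noteq> 0"
      using form_complement_nondegenerate[OF E NU[OF w]] by blast
    have "B (N y) w = 0" using polar y a by (simp add: w_def)
    with skew[OF y(1) w] y show False by simp
  qed
  moreover have "T w = N w + w"
    using V orthogonal_closed[OF T V(2)] unfolding N_def by (intro eq_vecI) auto
  ultimately have Tw: "T w = w" using V by simp
  define \<beta> where "\<beta> = B x w"
  \<comment> \<open>Adding a multiple of \<open>a\<close> keeps \<open>B v w = \<beta>\<close> and
    allows any value \<mu> of \<open>B v a\<close>. The displacement \<open>c\<close> below would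
    then have form 4 \<mu> (\<mu> - \<beta>) / \<open>B a a\<close>, which is nonzero for \<mu> = 2
    \<beta>.\<close>
  define v where "v = x + ((2 * \<beta> - B x a) / B a a) \<cdot>\<^sub>v a"
  have v: "v \<in> form_complement E" using U x a by (simp add: v_def)
  note V = V U(1)[OF x(1)] U(1)[OF v] U(1)[OF NU[OF v]]
  have vw: "B v w = \<beta>" and va: "B v a = 2 * \<beta>"
    using V a aw by (auto simp: v_def bform_simps \<beta>_def)
  have nz: "\<beta> \<noteq> 0" using x by (simp add: \<beta>_def)
  have Nva: "B (N v) a = - \<beta>" "B a (N v) = - \<beta>"
    using skew[OF v a(1)] vw by (auto simp: w_def bform_comm)
  have TvV: "T v \<in> Rpq" using T V by (simp add: orthogonal_closed)
  have "T v = N v + v" using TvV V unfolding N_def by (intro eq_vecI) auto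
  then have Tva: "B (T v) a = \<beta>" using V Nva va by (simp add: bform_simps)
  define S where "S = reflection p q a \<circ> T"
  have S: "S \<in> orthogonal_group p q"
    unfolding S_def using orthogonal_comp reflection_orthogonal T V a by blast
  have Sw: "S w = w"
    using Tw reflection_fixes[OF V(1) a(2) V(2)] aw by (simp add: S_def)
  have SE: "S e = e" if "e \<in> E" for e
    using reflection_fixes[OF V(1) a(2), of e] fixE[OF that] that EV a bform_comm[of p q a e]
    by (auto simp: S_def form_complement_def)
  have SvV: "S v \<in> Rpq" using S V by (simp add: orthogonal_closed)
  define c where "c = S v - v"
  have cV: "c \<in> Rpq" using SvV V by (simp add: c_def)
  have "c = N v - (2 * \<beta> / B a a) \<cdot>\<^sub>v a"
    using V TvV a unfolding c_def S_def N_def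
    by (intro eq_vecI) (auto simp: reflection_eq Tva)
  then have "B c c = 8 * \<beta>\<^sup>2 / B a a"
    using V a Nva polar[OF v v] by (simp add: bform_simps power2_eq_square field_simps)
  then have cc: "B c c \<noteq> 0" using nz a by simp
  \<comment> \<open>A vector fixed by the isometry \<open>S\<close> pairs equally with
    \<open>v\<close> and \<open>S v\<close>, hence is orthogonal to \<open>c\<close>.\<close>
  have fix_c: "reflection p q c y = y" if "y \<in> Rpq" "S y = y" for y
  proof (rule reflection_fixes[OF cV cc that(1)])
    show "B y c = 0"
      using orthogonal_bform[OF S that(1) V(4)] that SvV V by (simp add: c_def bform_simps)
  qed
  define R where "R = reflection p q c \<circ> S"
  have R: "R \<in> orthogonal_group p q"
    unfolding R_def using orthogonal_comp reflection_orthogonal S cV cc by blast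
  have "R v = v"
    using reflection_moves[OF SvV V(4) orthogonal_bform[OF S V(4) V(4)]] cc by (simp add: R_def c_def)
  moreover have "R w = w" using fix_c[OF V(2) Sw] Sw by (simp add: R_def)
  moreover have "R e = e" if "e \<in> E" for e
    using fix_c[of e] SE[OF that] that EV by (auto simp: R_def)
  ultimately obtain F where "orthogonal_frame F" "card F = card E + 2" "\<forall>f \<in> F. R f = f"
    using hyperbolic_plane_frame[OF E v w ww _ R] vw nz by blast
  with cV cc show ?thesis unfolding R_def S_def by blast
qed

section \<open>Induction on the codimension of the fixed frame\<close>

lemma reflection_product_codim:
  assumes "orthogonal_frame E" "T \<in> orthogonal_group p q" "\<And>e. e \<in> E \<Longrightarrow> T e = e"
  shows "reflection_product (p + q - card E) T"
  using assms
proof (induction "p + q - card E" arbitrary: E T rule: less_induct)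
  case less
  note E = less.prems(1) and T = less.prems(2) and fixE = less.prems(3)
  have EV: "E \<subseteq> Rpq" using E by (simp add: orthogonal_frame_def)
  note U = form_complement_closed[OF EV]
  show ?case
  proof (cases "form_complement E \<subseteq> {0\<^sub>v (p + q)}")
    case True
    then have "\<forall>v \<in> Rpq. T v = v"
      using orthogonal_identity_if_complement_trivial[OF E _ T] fixE by blast
    then show ?thesis
      unfolding reflection_product_def by (intro exI[of _ "[]"]) auto
  next
    case False
    then obtain a0 where a0: "a0 \<in> form_complement E" "B a0 a0 \<noteq> 0"
      using form_complement_anisotropic[OF E] by blast
    have step: "Suc (p + q - card (insert a E)) = p + q - card E"
      and frame: "orthogonal_frame (insert a E)"
      if "a \<in> form_complement E" "B a a \<noteq> 0" for a
      using orthogonal_frame_insert[OF E that] orthogonal_frame_card_le[of "insert a E"] by auto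
    show ?thesis
    proof (cases "\<exists>a \<in> form_complement E. B a a \<noteq> 0 \<and> (T a = a \<or> B (T a - a) (T a - a) \<noteq> 0)")
      case True
      then obtain a where a: "a \<in> form_complement E" "B a a \<noteq> 0"
        and or: "T a = a \<or> B (T a - a) (T a - a) \<noteq> 0" by blast
      note aV = U(1)[OF a(1)] and TaV = orthogonal_closed[OF T U(1)[OF a(1)]]
      show ?thesis
      proof (cases "T a = a")
        case True
        then have "reflection_product (p + q - card (insert a E)) T"
          using less.hyps[OF _ frame[OF a] T] step[OF a] fixE by auto
        \<comment> \<open>Here the frame grows without spending a reflection, so the bound is only
          weakened.\<close>
        then show ?thesis
          by (rule reflection_product_mono) (use step[OF a] in simp)
      next
        case False
        define c where "c = T a - a"
        have c: "c \<in> Rpq" "B c c \<noteq> 0" using or False aV TaV by (auto simp: c_def)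
        have cU: "c \<in> form_complement E"
          using U(3) form_complement_invariant[OF EV T fixE a(1)] a by (simp add: c_def)
        have R: "reflection p q c \<circ> T \<in> orthogonal_group p q"
          using orthogonal_comp reflection_orthogonal c T by blast
        \<comment> \<open>The reflection carries \<open>T a\<close> to \<open>a\<close>, and fixes
          \<open>E\<close> because \<open>c\<close> lies in its complement.\<close>
        have "(reflection p q c \<circ> T) e = e" if "e \<in> insert a E" for e
        proof (cases "e = a")
          case True
          then show ?thesis
            using reflection_moves[OF TaV aV orthogonal_bform[OF T aV aV]] c by (simp add: c_def)
        next
          case False
          then show ?thesis
            using that fixE cU EV reflection_fixes[OF c, of e] bform_comm[of p q c e]
            by (auto simp: form_complement_def)
        qed
        then have "reflection_product (p + q - card (insert a E)) (reflection p q c \<circ> T)"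
          using less.hyps[OF _ frame[OF a] R] step[OF a] by auto
        then show ?thesis
          using reflection_product_Suc[OF T c] step[OF a] by metis
      qed
    next
      case False
      then have "B (T u - u) (T u - u) = 0" if "u \<in> form_complement E" for u
        using displacement_totally_isotropic[OF E T _ a0 that] by blast
      then obtain c F where c: "c \<in> Rpq" "B c c \<noteq> 0" and F: "orthogonal_frame F" "card F = card E + 2"
        and fixF: "\<forall>f \<in> F. (reflection p q c \<circ> (reflection p q a0 \<circ> T)) f = f"
        using exceptional_reduction[OF E T fixE _ a0] False a0 by blast
      have a0V: "a0 \<in> Rpq" using U(1)[OF a0(1)] .
      have S: "reflection p q a0 \<circ> T \<in> orthogonal_group p q"
        using orthogonal_comp reflection_orthogonal a0V a0 T by blast
      have R: "reflection p q c \<circ> (reflection p q a0 \<circ> T) \<in> orthogonal_group p q"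
        using orthogonal_comp reflection_orthogonal c S by blast
      \<comment> \<open>Two reflections are paid for by exactly two new frame vectors.\<close>
      have card: "Suc (Suc (p + q - card F)) = p + q - card E"
        using orthogonal_frame_card_le[OF F(1)] F(2) by simp
      have "reflection_product (p + q - card F) (reflection p q c \<circ> (reflection p q a0 \<circ> T))"
        using less.hyps[OF _ F(1) R] card fixF by auto
      then show ?thesis
        using reflection_product_Suc[OF S c] reflection_product_Suc[OF T a0V a0(2)] card by metis
    qed
  qed
qed

end

theorem theorem3p4:
  fixes p q :: nat and T :: "real vec \<Rightarrow> real vec"
  assumes "T \<in> orthogonal_group p q"
  shows "\<exists>as :: real vec list.
           length as \<le> p + q \<and>
           (\<forall>a \<in> set as. a \<in> carrier_vec (p + q) \<and> bform p q a a \<noteq> 0) \<and>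
           (\<forall>v \<in> carrier_vec (p + q). T v = foldr (reflection p q) as v)"
  \<comment> \<open>The empty frame imposes no condition on \<open>T\<close> and has codimension
    \<open>p + q\<close>.\<close>
  using reflection_product_codim[of p q "{}" T] assms
  by (simp add: reflection_product_def orthogonal_frame_def)

end
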